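(* Let $\mathcal{K}\subset\mathbb{R}^N$ be a convex body with center of mass $M_{\mathcal{K}}$, heart $\heartsuit(\mathcal{K})$ and maximal folding function $\mathcal{R}_{\mathcal{K}}$. (i) If there exist $k$ ($1\le k\le N$) linearly independent directions $\omega_1,\dots,\omega_k\in\mathbb{S}^{N-1}$ such that $\mathcal{K}$ is $\omega_j$-symmetric for $j=1,\dots,k$, then $\mathcal{R}_{\mathcal{K}}(\omega_j)=\langle M_{\mathcal{K}},\omega_j\rangle$ for $j=1,\dots,k$ and $$\heartsuit(\mathcal{K})\subseteq\bigcap_{j=1}^k \pi_{\mathcal{R}_{\mathcal{K}}(\omega_j),\omega_j}.$$ In particular, the co-dimension of $\heartsuit(\mathcal{K})$ is at least $k$. (ii) If $\heartsuit(\mathcal{K})$ has dimension $k$ ($1\le k\le N-1$), then there exists at least one direction $\theta\in\mathbb{S}^{N-1}$ such that $\mathcal{R}_{\mathcal{K}}(\theta)=\langle M_{\mathcal{K}},\theta\rangle$ and $\mathcal{K}$ is $\theta$-symmetric.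
   Context: A convex body in $\mathbb{R}^N$ is a compact convex set with non-empty interior. $\langle\cdot,\cdot\rangle$ is the Euclidean scalar product and $\mathbb{S}^{N-1}$ the unit sphere. For $\omega\in\mathbb{S}^{N-1}$ and $\lambda\in\mathbb{R}$, $\pi_{\lambda,\omega}=\{x\in\mathbb{R}^N:\langle x,\omega\rangle=\lambda\}$, $T_{\lambda,\omega}$ is the reflection of $\mathbb{R}^N$ in the hyperplane $\pi_{\lambda,\omega}$, and $\mathcal{K}_{\lambda,\omega}=\{x\in\mathcal{K}:\langle x,\omega\rangle\ge\lambda\}$. The maximal folding function is $\mathcal{R}_{\mathcal{K}}(\omega)=\min\{\lambda\in\mathbb{R}: T_{\lambda,\omega}(\mathcal{K}_{\lambda,\omega})\subseteq\mathcal{K}\}$, $\omega\in\mathbb{S}^{N-1}$. The heart of $\mathcal{K}$ is $\heartsuit(\mathcal{K})=\{x\in\mathcal{K}:\langle x,\omega\rangle\le\mathcal{R}_{\mathcal{K}}(\omega)\text{ for every }\omega\in\mathbb{S}^{N-1}\}$. The center of mass is $M_{\mathcal{K}}=\frac{1}{|\mathcal{K}|}\int_{\mathcal{K}}y\,dy$. $\mathcal{K}$ is called $\omega$-symmetric if $T_{\lambda,\omega}(\mathcal{K})=\mathcal{K}$ for some $\lambda\in\mathbb{R}$. The dimension of a convex set is the dimension of its affine hull; its co-dimension is $N$ minus its dimension. *)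

theory Defs
  imports "HOL-Analysis.Analysis"
begin

definition convex_body :: "'a::euclidean_space set \<Rightarrow> bool" where
  "convex_body K \<longleftrightarrow> compact K \<and> convex K \<and> interior K \<noteq> {}"

definition hyperplane :: "real \<Rightarrow> 'a::euclidean_space \<Rightarrow> 'a set" where
  "hyperplane l w = {x. x \<bullet> w = l}"

(* This is the orthogonal reflection in hyperplane l w only for unit w; all uses below
   restrict to unit vectors. *)
definition hyper_reflection :: "real \<Rightarrow> 'a::euclidean_space \<Rightarrow> 'a \<Rightarrow> 'a" where
  "hyper_reflection l w x = x - (2 * (x \<bullet> w - l)) *\<^sub>R w"

definition body_cap :: "'a::euclidean_space set \<Rightarrow> real \<Rightarrow> 'a \<Rightarrow> 'a set" where
  "body_cap K l w = {x \<in> K. x \<bullet> w \<ge> l}"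

(* For a convex body K and unit w the set of admissible l is non-empty, closed and bounded
   below, so the minimum exists and LEAST denotes it. *)
definition max_folding :: "'a::euclidean_space set \<Rightarrow> 'a \<Rightarrow> real" where
  "max_folding K w = (LEAST l. hyper_reflection l w ` body_cap K l w \<subseteq> K)"

definition heart :: "'a::euclidean_space set \<Rightarrow> 'a set" where
  "heart K = {x \<in> K. \<forall>w \<in> sphere 0 1. x \<bullet> w \<le> max_folding K w}"

definition center_of_mass :: "'a::euclidean_space set \<Rightarrow> 'a" where
  "center_of_mass K = (1 / measure lborel K) *\<^sub>R (LINT y:K|lborel. y)"

definition dir_symmetric :: "'a::euclidean_space set \<Rightarrow> 'a \<Rightarrow> bool" where
  "dir_symmetric K w \<longleftrightarrow> (\<exists>l. hyper_reflection l w ` K = K)"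

definition aff_codim :: "'a::euclidean_space set \<Rightarrow> int" where
  "aff_codim S = int DIM('a) - aff_dim S"

end

theory Submission
  imports Defs
begin

text \<open>
  Write \<open>T\<close> for the reflection in the hyperplane at level \<open>l\<close> with unit normal \<open>w\<close>, and \<open>M\<close> for the
  center of mass of \<open>K\<close>. The function \<open>x \<mapsto> x \<bullet> w - l\<close> is odd under \<open>T\<close>, and \<open>T\<close> preserves volume, so
  the integral over \<open>x\<close> of \<open>(1\<^bsub>K\<^esub>(T x) - 1\<^bsub>K\<^esub>(x)) (x \<bullet> w - l)\<close> equals \<open>2 |K| (l - M \<bullet> w)\<close>
  (\<open>integral_fold_defect\<close>). If the cap above level \<open>l\<close> folds into \<open>K\<close>, the integrand is nonnegative
  at every point, whence \<open>M \<bullet> w \<le> l\<close>. In the case of equality the integrand vanishes almost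
  everywhere; as a convex body is the closure of its interior, \<open>T\<close> must then map \<open>K\<close> onto itself. So
  the maximal folding function \<open>R\<close> satisfies \<open>R w \<ge> M \<bullet> w\<close>, and \<open>R w = M \<bullet> w\<close> exactly when \<open>K\<close> is
  symmetric in direction \<open>w\<close> (\<open>max_folding_dir_symmetric\<close>, \<open>dir_symmetric_if_fold_at_center\<close>).

  For the first part, symmetry in direction \<open>w\<close> is also symmetry in direction \<open>- w\<close>, so a point of the
  heart satisfies \<open>x \<bullet> w \<le> M \<bullet> w\<close> and the reverse inequality. The heart thus lies in \<open>k\<close>
  hyperplanes through \<open>M\<close> with independent normals, which gives the codimension.

  For the second part, \<open>R\<close> is lower semicontinuous, because the set of pairs \<open>(w, l)\<close> whose cap folds
  into \<open>K\<close> is closed. Hence the gap \<open>R w - M \<bullet> w\<close> attains its minimum on the unit sphere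
  (\<open>folding_gap_attains_min\<close>). If this minimum were some \<open>\<delta> > 0\<close>, the heart would contain
  all points of \<open>K\<close> within distance \<open>\<delta>\<close> of \<open>M\<close> and so would have full dimension
  (\<open>aff_dim_heart_if_positive_gap\<close>). Therefore the minimum is \<open>0\<close>, and a minimizing direction is one in
  which \<open>K\<close> is symmetric.
\<close>

section \<open>Invariance of Lebesgue measure under reflections\<close>

lemma nn_integral_lborel_translation:
  fixes h :: "'a::euclidean_space \<Rightarrow> ennreal"
  assumes [measurable]: "h \<in> borel_measurable borel"
  shows "(\<integral>\<^sup>+x. h (c + x) \<partial>lborel) = (\<integral>\<^sup>+x. h x \<partial>lborel)"
proof -
  have "(\<integral>\<^sup>+x. h (c + x) \<partial>lborel) = (\<integral>\<^sup>+x. h x \<partial>distr lborel borel ((+) c))"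
    by (subst nn_integral_distr) auto
  then show ?thesis
    by (simp add: lborel_distr_plus)
qed

text \<open>The uniqueness argument for Haar measure. For the unit ball \<open>B\<close> and a Borel set \<open>A\<close>, integrate
  \<open>1\<^bsub>B\<^esub>(x) 1\<^bsub>A\<^esub>(x + T y)\<close> over all pairs \<open>(x, y)\<close>. Integrating over \<open>y\<close> first, translation invariance
  turns the double integral into \<open>|B|\<close> times the image measure of \<open>A\<close>. Integrating over \<open>x\<close> first,
  the shift by \<open>T y\<close> moves to the ball, and since \<open>T\<close> fixes \<open>B\<close> the result is \<open>|B| |A|\<close>. As \<open>|B|\<close> is
  positive and finite it cancels.\<close>

lemma lborel_distr_orthogonal_transformation:
  fixes T :: "'a::euclidean_space \<Rightarrow> 'a"
  assumes T: "orthogonal_transformation T"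
  shows "distr lborel borel T = lborel"
proof (rule measure_eqI)
  show "sets (distr lborel borel T) = sets lborel"
    by simp
  have lin: "linear T"
    using T by (simp add: orthogonal_transformation_def)
  have [measurable]: "T \<in> borel_measurable borel"
    using lin by (intro borel_measurable_continuous_onI linear_continuous_on) (simp add: linear_conv_bounded_linear)
  let ?B = "ball 0 1 :: 'a set"
  fix A assume "A \<in> sets (distr lborel borel T)"
  then have [measurable]: "A \<in> sets borel" by simp
  let ?f = "indicator ?B :: 'a \<Rightarrow> ennreal"
  let ?g = "indicator A :: 'a \<Rightarrow> ennreal"
  have f_meas [measurable]: "?f \<in> borel_measurable borel"
    by (intro borel_measurable_indicator borel_open open_ball)
  have surj: "\<exists>z. T z = x" for x
    using orthogonal_transformation_surj[OF T] by (metis surjD)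
  have shift: "(\<integral>\<^sup>+y. h (x + T y) \<partial>lborel) = (\<integral>\<^sup>+y. h (T y) \<partial>lborel)"
    if [measurable]: "h \<in> borel_measurable borel" for h :: "'a \<Rightarrow> ennreal" and x
  proof -
    obtain z where z: "T z = x" using surj by blast
    have "(\<integral>\<^sup>+y. h (x + T y) \<partial>lborel) = (\<integral>\<^sup>+y. h (T (z + y)) \<partial>lborel)"
      by (simp add: linear_add[OF lin] z)
    also have "\<dots> = (\<integral>\<^sup>+y. h (T y) \<partial>lborel)"
      by (rule nn_integral_lborel_translation[where h = "\<lambda>y. h (T y)"]) simp
    finally show ?thesis .
  qed
  have fT: "?f (T y) = ?f y" for y
    using orthogonal_transformation_norm[OF T, of y] by (simp add: indicator_def)
  have fsym: "?f (x - y) = ?f (- x + y)" for x y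
    by (simp add: indicator_def norm_minus_commute)
  have "emeasure (distr lborel borel T) A = (\<integral>\<^sup>+y. ?g y \<partial>distr lborel borel T)"
    by simp
  also have "\<dots> = (\<integral>\<^sup>+y. ?g (T y) \<partial>lborel)"
    by (rule nn_integral_distr) auto
  finally have distr_A: "emeasure (distr lborel borel T) A = (\<integral>\<^sup>+y. ?g (T y) \<partial>lborel)" .
  have "emeasure lborel ?B * emeasure (distr lborel borel T) A
      = (\<integral>\<^sup>+x. ?f x * (\<integral>\<^sup>+y. ?g (T y) \<partial>lborel) \<partial>lborel)"
    unfolding distr_A by (subst nn_integral_multc) simp_all
  also have "\<dots> = (\<integral>\<^sup>+x. (\<integral>\<^sup>+y. ?f x * ?g (x + T y) \<partial>lborel) \<partial>lborel)"
    by (simp add: nn_integral_cmult shift[of ?g])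
  also have "\<dots> = (\<integral>\<^sup>+y. (\<integral>\<^sup>+x. ?f x * ?g (x + T y) \<partial>lborel) \<partial>lborel)"
    by (rule lborel_pair.Fubini') measurable
  also have "\<dots> = (\<integral>\<^sup>+y. (\<integral>\<^sup>+x. ?f (x - T y) * ?g x \<partial>lborel) \<partial>lborel)"
  proof (rule nn_integral_cong)
    fix y
    show "(\<integral>\<^sup>+x. ?f x * ?g (x + T y) \<partial>lborel) = (\<integral>\<^sup>+x. ?f (x - T y) * ?g x \<partial>lborel)"
      using nn_integral_lborel_translation[of "\<lambda>x. ?f (x - T y) * ?g x" "T y"]
      by (simp add: add.commute)
  qed
  also have "\<dots> = (\<integral>\<^sup>+x. (\<integral>\<^sup>+y. ?f (x - T y) * ?g x \<partial>lborel) \<partial>lborel)"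
    by (rule lborel_pair.Fubini'[symmetric]) measurable
  also have "\<dots> = (\<integral>\<^sup>+x. emeasure lborel ?B * ?g x \<partial>lborel)"
  proof (rule nn_integral_cong)
    fix x
    have "(\<integral>\<^sup>+y. ?f (x - T y) * ?g x \<partial>lborel) = (\<integral>\<^sup>+y. ?f (- x + T y) \<partial>lborel) * ?g x"
      unfolding fsym by (rule nn_integral_multc) measurable
    also have "(\<integral>\<^sup>+y. ?f (- x + T y) \<partial>lborel) = (\<integral>\<^sup>+y. ?f y \<partial>lborel)"
      by (simp only: shift[OF f_meas] fT)
    finally show "(\<integral>\<^sup>+y. ?f (x - T y) * ?g x \<partial>lborel) = emeasure lborel ?B * ?g x"
      by simp
  qed
  also have "\<dots> = emeasure lborel ?B * emeasure lborel A"
    by (simp add: nn_integral_cmult)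
  finally have "emeasure lborel ?B * emeasure (distr lborel borel T) A = emeasure lborel ?B * emeasure lborel A" .
  moreover have "emeasure lborel ?B \<noteq> 0"
    using content_ball_gt_0_iff[of "0::'a" 1] by (auto simp: measure_def)
  moreover have "emeasure lborel ?B \<noteq> top"
    using emeasure_lborel_ball_finite[of "0::'a" 1] by auto
  ultimately show "emeasure (distr lborel borel T) A = emeasure lborel A"
    by (metis ennreal_mult_cancel_left)
qed

lemma hyper_reflection_inner:
  "norm w = 1 \<Longrightarrow> hyper_reflection l w x \<bullet> w = 2 * l - x \<bullet> w"
  by (simp add: hyper_reflection_def inner_diff_left dot_square_norm)

lemma hyper_reflection_involutive:
  assumes "norm w = 1"
  shows "hyper_reflection l w (hyper_reflection l w x) = x"
proof -
  have "hyper_reflection l w (hyper_reflection l w x)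
      = hyper_reflection l w x - (2 * (hyper_reflection l w x \<bullet> w - l)) *\<^sub>R w"
    by (simp add: hyper_reflection_def)
  also have "\<dots> = hyper_reflection l w x + (2 * (x \<bullet> w - l)) *\<^sub>R w"
    using assms by (simp add: hyper_reflection_inner algebra_simps flip: scaleR_add_left)
  finally show ?thesis
    by (simp add: hyper_reflection_def)
qed

lemma hyper_reflection_fixed: "x \<bullet> w = l \<Longrightarrow> hyper_reflection l w x = x"
  by (simp add: hyper_reflection_def)

lemma hyper_reflection_uminus: "hyper_reflection (- l) (- w) = hyper_reflection l w"
  by (rule ext) (simp add: hyper_reflection_def algebra_simps)

lemma continuous_on_hyper_reflection [continuous_intros]:
  "continuous_on S (hyper_reflection l w)"
  unfolding hyper_reflection_def by (intro continuous_intros)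

lemma borel_measurable_hyper_reflection [measurable]:
  "hyper_reflection l w \<in> borel_measurable borel"
  by (intro borel_measurable_continuous_onI continuous_on_hyper_reflection)

lemma orthogonal_transformation_hyper_reflection:
  fixes w :: "'a::euclidean_space"
  assumes "norm w = 1"
  shows "orthogonal_transformation (hyper_reflection 0 w)"
  unfolding orthogonal_transformation_def
proof
  show "linear (hyper_reflection 0 w)"
    by (rule linearI) (simp_all add: hyper_reflection_def algebra_simps)
  show "\<forall>v u. hyper_reflection 0 w v \<bullet> hyper_reflection 0 w u = v \<bullet> u"
    using assms
    by (simp add: hyper_reflection_def inner_diff_left inner_diff_right dot_square_norm inner_commute)
qed

lemma lborel_distr_hyper_reflection:
  fixes w :: "'a::euclidean_space"
  assumes w: "norm w = 1"
  shows "distr lborel borel (hyper_reflection l w) = lborel"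
proof -
  have "hyper_reflection l w = (\<lambda>x. (2 * l) *\<^sub>R w + x) \<circ> hyper_reflection 0 w"
    by (rule ext) (simp add: hyper_reflection_def algebra_simps)
  then have "distr lborel borel (hyper_reflection l w)
      = distr (distr lborel borel (hyper_reflection 0 w)) borel (\<lambda>x. (2 * l) *\<^sub>R w + x)"
    by (simp add: distr_distr)
  then show ?thesis
    by (simp add: lborel_distr_orthogonal_transformation orthogonal_transformation_hyper_reflection w
        lborel_distr_plus)
qed

section \<open>The center of mass and admissible folds\<close>

lemma convex_body_measure_pos:
  fixes K :: "'a::euclidean_space set"
  assumes "convex_body K"
  shows "0 < measure lborel K"
proof -
  obtain x r where "0 < r" "ball x r \<subseteq> K"
    using assms by (metis convex_body_def all_not_in_conv mem_interior)
  moreover have "K \<in> fmeasurable lborel"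
    using assms by (simp add: convex_body_def fmeasurable_compact)
  ultimately have "measure lborel (ball x r) \<le> measure lborel K"
    by (intro measure_mono_fmeasurable) auto
  then show ?thesis
    using content_ball_gt_0_iff[of x r] \<open>0 < r\<close> by linarith
qed

text \<open>At \<open>x\<close>, the difference between the indicators of the reflected body and of the body itself,
  weighted with the signed distance from the mirror; it measures how far \<open>K\<close> is from being symmetric.\<close>

definition fold_defect :: "'a::euclidean_space set \<Rightarrow> real \<Rightarrow> 'a \<Rightarrow> 'a \<Rightarrow> real" where
  "fold_defect K l w x
    = (indicator K (hyper_reflection l w x) - indicator K x) * (x \<bullet> w - l)"

text \<open>Substituting \<open>T x\<close> for \<open>x\<close> negates the weight, so the reflected body contributes the same
  amount as the body itself. That amount is the first moment of \<open>K\<close> about the mirror, which the center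
  of mass computes.\<close>

lemma integral_fold_defect:
  fixes K :: "'a::euclidean_space set"
  assumes K: "convex_body K" and w: "norm w = 1"
  shows "integrable lborel (fold_defect K l w)"
    and "(\<integral>x. fold_defect K l w x \<partial>lborel) = 2 * measure lborel K * (l - center_of_mass K \<bullet> w)"
proof -
  let ?T = "hyper_reflection l w"
  let ?h = "\<lambda>x. indicator K x * (x \<bullet> w - l)"
  have comp: "compact K" using K by (simp add: convex_body_def)
  have [measurable]: "K \<in> sets borel"
    using comp by (simp add: borel_compact)
  have int_id: "integrable lborel (\<lambda>x. indicator K x *\<^sub>R x)"
    by (intro borel_integrable_compact comp continuous_intros)
  have int_1: "integrable lborel (indicator K :: 'a \<Rightarrow> real)"
    using borel_integrable_compact[OF comp, of "\<lambda>_. 1::real"] by simp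
  have h_eq: "?h = (\<lambda>x. (indicator K x *\<^sub>R x) \<bullet> w - l * indicator K x)"
    by (rule ext) (simp add: algebra_simps)
  have int_h: "integrable lborel ?h"
    unfolding h_eq using int_id int_1
    by (intro Bochner_Integration.integrable_diff integrable_inner_left integrable_mult_right)
  have "(\<integral>x. ?h x \<partial>lborel) = (\<integral>x. indicator K x *\<^sub>R x \<partial>lborel) \<bullet> w - l * measure lborel K"
    unfolding h_eq using int_id int_1
    by (subst Bochner_Integration.integral_diff) (simp_all del: inner_scaleR_left)
  also have "(\<integral>x. indicator K x *\<^sub>R x \<partial>lborel) = measure lborel K *\<^sub>R center_of_mass K"
    using convex_body_measure_pos[OF K] by (simp add: center_of_mass_def set_lebesgue_integral_def)
  finally have val: "(\<integral>x. ?h x \<partial>lborel) = measure lborel K * (center_of_mass K \<bullet> w - l)"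
    by (simp add: algebra_simps)
  have [measurable]: "?h \<in> borel_measurable borel"
    by measurable
  have int_hT: "integrable lborel (\<lambda>x. ?h (?T x))"
    using int_h by (subst integrable_distr_eq[symmetric, where N = borel and f = ?h])
      (simp_all add: lborel_distr_hyper_reflection w)
  have val_T: "(\<integral>x. ?h (?T x) \<partial>lborel) = (\<integral>x. ?h x \<partial>lborel)"
    by (subst integral_distr[symmetric, where N = borel and f = ?h])
      (simp_all add: lborel_distr_hyper_reflection w)
  (* Oddness of the weight: the value of \<open>?h\<close> at the reflected point carries a minus sign. *)
  have defect: "fold_defect K l w = (\<lambda>x. - ?h (?T x) - ?h x)"
    using w by (auto simp: fold_defect_def hyper_reflection_inner algebra_simps)
  show "integrable lborel (fold_defect K l w)"
    unfolding defect using int_h int_hT by (intro Bochner_Integration.integrable_diff integrable_minus)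
  have "(\<integral>x. fold_defect K l w x \<partial>lborel) = - (\<integral>x. ?h (?T x) \<partial>lborel) - (\<integral>x. ?h x \<partial>lborel)"
    unfolding defect
    using int_h int_hT by (simp only: Bochner_Integration.integral_diff integrable_minus integral_minus)
  then show "(\<integral>x. fold_defect K l w x \<partial>lborel) = 2 * measure lborel K * (l - center_of_mass K \<bullet> w)"
    unfolding val_T val by (simp add: algebra_simps)
qed

definition admits_fold :: "'a::euclidean_space set \<Rightarrow> real \<Rightarrow> 'a \<Rightarrow> bool" where
  "admits_fold K l w \<longleftrightarrow> hyper_reflection l w ` body_cap K l w \<subseteq> K"

lemma admits_foldD: "admits_fold K l w \<Longrightarrow> x \<in> K \<Longrightarrow> l \<le> x \<bullet> w \<Longrightarrow> hyper_reflection l w x \<in> K"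
  by (auto simp: admits_fold_def body_cap_def)

text \<open>Points on the mirror are fixed by the reflection, so only points strictly above it matter. The
  disjunction has a non-strict inequality, hence describes a closed set of pairs \<open>(w, l)\<close>.\<close>

lemma admits_fold_iff:
  "admits_fold K l w \<longleftrightarrow> (\<forall>x\<in>K. x \<bullet> w \<le> l \<or> hyper_reflection l w x \<in> K)"
proof
  show "admits_fold K l w" if *: "\<forall>x\<in>K. x \<bullet> w \<le> l \<or> hyper_reflection l w x \<in> K"
    unfolding admits_fold_def body_cap_def
  proof safe
    fix x assume "x \<in> K" "l \<le> x \<bullet> w"
    then show "hyper_reflection l w x \<in> K"
      using * hyper_reflection_fixed[of x w l] by force
  qed
qed (use admits_foldD[of K l w] in force)

text \<open>Above the mirror the fold carries \<open>K\<close> into \<open>K\<close>, so there the reflected indicator is the larger one.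
  Below the mirror apply the same to the reflected point: the order of the indicators is reversed,
  and so is the sign of the weight.\<close>

lemma fold_defect_nonneg:
  assumes fold: "admits_fold K l w" and w: "norm w = 1"
  shows "0 \<le> fold_defect K l w x"
proof -
  let ?T = "hyper_reflection l w"
  have "?T x \<in> K" if "x \<in> K" "l \<le> x \<bullet> w"
    using admits_foldD[OF fold] that by blast
  moreover have "x \<in> K" if "?T x \<in> K" "x \<bullet> w \<le> l"
    using admits_foldD[OF fold, of "?T x"] that w
    by (simp add: hyper_reflection_inner hyper_reflection_involutive)
  ultimately show ?thesis
    unfolding fold_defect_def indicator_def by (cases "x \<bullet> w \<le> l") auto
qed

lemma center_of_mass_le_admits_fold:
  assumes K: "convex_body K" and w: "norm w = 1" and fold: "admits_fold K l w"
  shows "center_of_mass K \<bullet> w \<le> l"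
proof -
  have "0 \<le> (\<integral>x. fold_defect K l w x \<partial>lborel)"
    using fold_defect_nonneg[OF fold w] by (intro Bochner_Integration.integral_nonneg) simp
  then show ?thesis
    using convex_body_measure_pos[OF K]
    by (simp add: integral_fold_defect[OF K w] zero_le_mult_iff)
qed

text \<open>A nonnegative function with integral \<open>0\<close> vanishes almost everywhere, but symmetry is needed at every
  point. Were some point of \<open>K\<close> reflected outside \<open>K\<close>, it would lie below the mirror, and nearby interior
  points of \<open>K\<close> would form a nonempty open set on which the defect is positive.\<close>

lemma dir_symmetric_if_fold_at_center:
  fixes K :: "'a::euclidean_space set"
  assumes K: "convex_body K" and w: "norm w = 1"
    and fold: "admits_fold K (center_of_mass K \<bullet> w) w"
  shows "dir_symmetric K w"
proof -
  define l where "l = center_of_mass K \<bullet> w"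
  let ?T = "hyper_reflection l w"
  note fold = fold[folded l_def]
  have cl: "closed K" and cli: "closure (interior K) = K"
    using K by (auto simp: convex_body_def compact_imp_closed convex_closure_interior)
  have "(\<integral>x. fold_defect K l w x \<partial>lborel) = 0"
    using integral_fold_defect(2)[OF K w, of l] by (simp add: l_def)
  then have ae: "AE x in lborel. fold_defect K l w x = 0"
    using integral_fold_defect(1)[OF K w] fold_defect_nonneg[OF fold w]
    by (subst (asm) integral_nonneg_eq_0_iff_AE) auto
  have sub: "?T x \<in> K" if x: "x \<in> K" for x
  proof (rule ccontr)
    assume Tx: "?T x \<notin> K"
    then have "x \<bullet> w < l"
      using admits_foldD[OF fold x] by force
    define V where "V = {y. y \<bullet> w < l} \<inter> ?T -` (- K)"
    have "open V"
      unfolding V_def using cl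
      by (intro open_Int open_vimage continuous_intros open_Compl open_Collect_less)
    moreover have "x \<in> V"
      using \<open>x \<bullet> w < l\<close> Tx by (simp add: V_def)
    ultimately have "V \<inter> interior K \<noteq> {}"
      using x cli by (metis disjoint_iff open_Int_closure_eq_empty)
    moreover have "open (V \<inter> interior K)"
      using \<open>open V\<close> by blast
    ultimately have "\<not> negligible (V \<inter> interior K)"
      using open_not_negligible by blast
    moreover have "V \<inter> interior K \<subseteq> {x. fold_defect K l w x \<noteq> 0}"
      using interior_subset[of K] by (auto simp: V_def fold_defect_def)
    moreover have "negligible {x. fold_defect K l w x \<noteq> 0}"
      using AE_completion[OF ae] null_sets_completion_subset
      by (auto simp: negligible_iff_null_sets eventually_ae_filter)
    ultimately show False
      using negligible_subset by blast
  qed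
  have "?T ` K = K"
  proof
    show "K \<subseteq> ?T ` K"
      using sub w by (metis hyper_reflection_involutive image_eqI subsetI)
  qed (use sub in blast)
  then show ?thesis
    unfolding dir_symmetric_def by blast
qed

section \<open>The maximal folding function\<close>

lemma closed_admits_fold:
  fixes K :: "'a::euclidean_space set"
  assumes "closed K"
  shows "closed {(w, l). admits_fold K l w}"
proof -
  have "{(w, l). admits_fold K l w}
      = (\<Inter>x\<in>K. {p. x \<bullet> fst p \<le> snd p} \<union> (\<lambda>p. hyper_reflection (snd p) (fst p) x) -` K)"
    by (auto simp: admits_fold_iff)
  also have "closed \<dots>"
    using assms unfolding hyper_reflection_def
    by (intro closed_INT ballI closed_Un closed_Collect_le closed_vimage continuous_intros)
  finally show ?thesis .
qed

lemma admits_fold_outside: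
  assumes "\<And>x. x \<in> K \<Longrightarrow> x \<bullet> w \<le> l"
  shows "admits_fold K l w"
  using assms by (simp add: admits_fold_iff)

lemma admits_fold_radius:
  assumes b: "\<And>x. x \<in> K \<Longrightarrow> norm x \<le> b" and w: "norm w = 1"
  shows "admits_fold K b w"
proof (rule admits_fold_outside)
  fix x assume "x \<in> K"
  then show "x \<bullet> w \<le> b"
    using norm_cauchy_schwarz[of x w] b[of x] w by simp
qed

text \<open>The admissible levels form a closed set, nonempty because high mirrors miss \<open>K\<close>, and bounded below
  by the level of the center of mass. So their infimum is attained, and \<open>LEAST\<close> in the definition
  of the maximal folding function denotes it.\<close>

lemma max_folding_least:
  assumes K: "convex_body K" and w: "norm w = 1"
  shows "admits_fold K (max_folding K w) w"
    and "admits_fold K l w \<Longrightarrow> max_folding K w \<le> l"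
proof -
  let ?S = "{l. admits_fold K l w}"
  have "bounded K" "closed K"
    using K by (auto simp: convex_body_def compact_imp_bounded compact_imp_closed)
  then obtain b where "\<And>x. x \<in> K \<Longrightarrow> norm x \<le> b"
    by (auto simp: bounded_iff)
  then have "admits_fold K b w"
    using w by (intro admits_fold_radius)
  then have ne: "?S \<noteq> {}" by blast
  have bdd: "bdd_below ?S"
    using center_of_mass_le_admits_fold[OF K w] by (intro bdd_belowI) blast
  have "closed ((\<lambda>l. (w, l)) -` {(w, l). admits_fold K l w})"
    using \<open>closed K\<close> by (intro closed_vimage closed_admits_fold continuous_intros)
  then have "closed ?S"
    by (simp add: vimage_def)
  then have Inf: "admits_fold K (Inf ?S) w"
    using closed_contains_Inf[OF ne bdd] by simp
  have le: "Inf ?S \<le> l" if "admits_fold K l w" for l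
    using that bdd by (simp add: cInf_lower)
  have eq: "max_folding K w = Inf ?S"
    unfolding max_folding_def admits_fold_def[symmetric]
    using Inf le by (rule Least_equality)
  show "admits_fold K (max_folding K w) w"
    using Inf eq by simp
  show "admits_fold K l w \<Longrightarrow> max_folding K w \<le> l"
    using le eq by simp
qed

lemma center_of_mass_le_max_folding:
  assumes "convex_body K" and "norm w = 1"
  shows "center_of_mass K \<bullet> w \<le> max_folding K w"
  using assms by (intro center_of_mass_le_admits_fold max_folding_least)

lemma max_folding_dir_symmetric:
  assumes K: "convex_body K" and w: "norm w = 1" and sym: "dir_symmetric K w"
  shows "max_folding K w = center_of_mass K \<bullet> w"
proof -
  obtain l where l: "hyper_reflection l w ` K = K"
    using sym by (auto simp: dir_symmetric_def)
  have "hyper_reflection l w x \<in> K \<longleftrightarrow> x \<in> K" for x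
    using l w by (metis hyper_reflection_involutive imageI)
  then have "(\<integral>x. fold_defect K l w x \<partial>lborel) = 0"
    by (simp add: fold_defect_def indicator_def)
  then have "l = center_of_mass K \<bullet> w"
    using integral_fold_defect(2)[OF K w, of l] convex_body_measure_pos[OF K] by simp
  moreover have "admits_fold K l w"
    using l by (auto simp: admits_fold_def body_cap_def)
  ultimately show ?thesis
    using max_folding_least(2)[OF K w] center_of_mass_le_max_folding[OF K w] by force
qed

text \<open>Lower semicontinuity in disguise: rather than minimizing the gap, which need not be continuous,
  minimize the continuous function \<open>l - M \<bullet> w\<close> over the pairs \<open>(w, l)\<close> that admit a fold. Bounding
  \<open>l\<close> makes this set of pairs compact, and it still contains the graph of the maximal folding function.\<close>

lemma folding_gap_attains_min:
  fixes K :: "'a::euclidean_space set"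
  assumes K: "convex_body K"
  obtains \<theta> where "norm \<theta> = 1"
    and "\<And>w. norm w = 1 \<Longrightarrow>
      max_folding K \<theta> - center_of_mass K \<bullet> \<theta> \<le> max_folding K w - center_of_mass K \<bullet> w"
proof -
  define M where "M = center_of_mass K"
  have "bounded K" "closed K"
    using K by (auto simp: convex_body_def compact_imp_bounded compact_imp_closed)
  then obtain b where b: "\<And>x. x \<in> K \<Longrightarrow> norm x \<le> b"
    by (auto simp: bounded_iff)
  let ?G = "(sphere 0 1 \<times> {- norm M..b}) \<inter> {(w, l). admits_fold K l w}"
  have "compact ?G"
    using \<open>closed K\<close> by (intro compact_Int_closed compact_Times closed_admits_fold) auto
  have G: "(w, max_folding K w) \<in> ?G" if w: "norm w = 1" for w
  proof -
    have "admits_fold K b w"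
      using b w by (intro admits_fold_radius)
    then have "max_folding K w \<le> b"
      by (rule max_folding_least(2)[OF K w])
    moreover have "- norm M \<le> M \<bullet> w"
      using Cauchy_Schwarz_ineq2[of M w] w by simp
    ultimately show ?thesis
      using w center_of_mass_le_max_folding[OF K w] max_folding_least(1)[OF K w] by (simp add: M_def)
  qed
  obtain e :: 'a where "norm e = 1"
    using vector_choose_size[of 1] by auto
  then have "?G \<noteq> {}"
    using G by blast
  moreover have "continuous_on ?G (\<lambda>q. snd q - M \<bullet> fst q)"
    by (intro continuous_intros)
  ultimately obtain p where p: "p \<in> ?G"
    and min: "\<And>q. q \<in> ?G \<Longrightarrow> snd p - M \<bullet> fst p \<le> snd q - M \<bullet> fst q"
    using continuous_attains_inf[OF \<open>compact ?G\<close>] by blast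
  obtain \<theta> l where pe: "p = (\<theta>, l)" by (cases p)
  have \<theta>: "norm \<theta> = 1" and fold: "admits_fold K l \<theta>"
    using p by (auto simp: pe)
  show thesis
  proof (rule that[OF \<theta>])
    fix w :: 'a assume w: "norm w = 1"
    have "max_folding K \<theta> \<le> l"
      by (rule max_folding_least(2)[OF K \<theta> fold])
    then show "max_folding K \<theta> - center_of_mass K \<bullet> \<theta> \<le> max_folding K w - center_of_mass K \<bullet> w"
      using min[OF G[OF w]] by (simp add: pe M_def)
  qed
qed

section \<open>The heart\<close>

text \<open>A half-space that contains \<open>K\<close> gives a mirror with no point of \<open>K\<close> above it. That fold is trivially
  admissible, so the half-space also contains the center of mass; separation then excludes a center
  of mass outside \<open>K\<close>.\<close>

lemma center_of_mass_in:
  fixes K :: "'a::euclidean_space set"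
  assumes K: "convex_body K"
  shows "center_of_mass K \<in> K"
proof (rule ccontr)
  assume "center_of_mass K \<notin> K"
  moreover have "convex K" "closed K"
    using K by (auto simp: convex_body_def compact_imp_closed)
  ultimately obtain a b where a: "a \<bullet> center_of_mass K < b" and b: "\<And>x. x \<in> K \<Longrightarrow> b < a \<bullet> x"
    using separating_hyperplane_closed_point[of K "center_of_mass K"] by blast
  have "K \<noteq> {}"
    using K by (auto simp: convex_body_def)
  then have "a \<noteq> 0"
    using a b by force
  define w where "w = - (a /\<^sub>R norm a)"
  have w: "norm w = 1"
    using \<open>a \<noteq> 0\<close> by (simp add: w_def)
  have "admits_fold K (- (b / norm a)) w"
    using b \<open>a \<noteq> 0\<close>
    by (intro admits_fold_outside) (simp add: w_def inner_commute divide_inverse mult.commute less_imp_le)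
  then have "center_of_mass K \<bullet> w \<le> - (b / norm a)"
    by (rule center_of_mass_le_admits_fold[OF K w])
  then show False
    using a \<open>a \<noteq> 0\<close> by (simp add: w_def inner_commute divide_inverse mult.commute)
qed

text \<open>Reversing the normal gives the same mirror, so \<open>K\<close> is also symmetric in direction \<open>- w\<close>, and the
  constraints on the heart in the two directions are opposite inequalities.\<close>

lemma heart_subset_hyperplane:
  assumes K: "convex_body K" and w: "norm w = 1" and sym: "dir_symmetric K w"
  shows "heart K \<subseteq> hyperplane (center_of_mass K \<bullet> w) w"
proof
  fix x assume x: "x \<in> heart K"
  have "dir_symmetric K (- w)"
    using sym unfolding dir_symmetric_def by (metis hyper_reflection_uminus)
  then have "max_folding K (- w) = center_of_mass K \<bullet> (- w)"
    using max_folding_dir_symmetric[OF K] w by simp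
  moreover have "x \<bullet> (- w) \<le> max_folding K (- w)" "x \<bullet> w \<le> max_folding K w"
    using x w by (simp_all add: heart_def del: inner_minus_right)
  ultimately show "x \<in> hyperplane (center_of_mass K \<bullet> w) w"
    using max_folding_dir_symmetric[OF K w sym] by (simp add: hyperplane_def)
qed

text \<open>After translation by \<open>- c\<close>, the set lies in the orthogonal complement of the span of \<open>B\<close>.\<close>

lemma aff_codim_ge_card_normals:
  fixes S B :: "'a::euclidean_space set"
  assumes B: "independent B" and S: "\<And>x b. x \<in> S \<Longrightarrow> b \<in> B \<Longrightarrow> x \<bullet> b = c \<bullet> b"
  shows "int (card B) \<le> aff_codim S"
proof -
  let ?P = "{y \<in> UNIV. \<forall>x \<in> span B. orthogonal x y}"
  have "(\<lambda>x. x - c) ` S \<subseteq> ?P"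
  proof safe
    fix x y assume "x \<in> S" "y \<in> span B"
    then show "orthogonal y (x - c)"
      by (subst orthogonal_commute, intro orthogonal_to_span[of y B])
        (auto simp: orthogonal_def inner_diff_left S)
  qed simp
  then have "aff_dim S \<le> aff_dim ?P"
    by (metis aff_dim_subset aff_dim_translation_eq_subtract)
  also have "\<dots> = int (dim ?P)"
    by (intro aff_dim_subspace) (simp add: subspace_orthogonal_to_vectors)
  finally have "aff_dim S \<le> int (dim ?P)" .
  moreover have "dim ?P + card B = DIM('a)"
    using dim_subspace_orthogonal_to_vectors[of "span B" "UNIV :: 'a set"] B
    by (simp add: dim_eq_card_independent)
  ultimately show ?thesis
    unfolding aff_codim_def by linarith
qed

text \<open>By the Cauchy-Schwarz inequality a step shorter than \<open>\<delta>\<close> away from the center of mass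
  violates none of the constraints on the heart. The center of mass is a limit of interior points of \<open>K\<close>,
  so such steps reach an open set of points of \<open>K\<close>.\<close>

lemma aff_dim_heart_if_positive_gap:
  fixes K :: "'a::euclidean_space set"
  assumes K: "convex_body K" and "0 < \<delta>"
    and gap: "\<And>w. norm w = 1 \<Longrightarrow> \<delta> \<le> max_folding K w - center_of_mass K \<bullet> w"
  shows "aff_dim (heart K) = DIM('a)"
proof -
  let ?M = "center_of_mass K"
  have "?M \<in> closure (interior K)"
    using K center_of_mass_in[OF K]
    by (simp add: convex_body_def convex_closure_interior compact_imp_closed)
  then have "ball ?M \<delta> \<inter> interior K \<noteq> {}"
    using \<open>0 < \<delta>\<close> by (metis centre_in_ball disjoint_iff open_Int_closure_eq_empty open_ball)
  moreover have "ball ?M \<delta> \<inter> interior K \<subseteq> heart K"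
  proof
    fix x assume x: "x \<in> ball ?M \<delta> \<inter> interior K"
    have "x \<bullet> w \<le> max_folding K w" if w: "norm w = 1" for w
    proof -
      have "(x - ?M) \<bullet> w \<le> norm (x - ?M)"
        using norm_cauchy_schwarz[of "x - ?M" w] w by simp
      also have "\<dots> < \<delta>"
        using x by (simp add: dist_norm norm_minus_commute)
      finally show ?thesis
        using gap[OF w] by (simp add: inner_diff_left)
    qed
    then show "x \<in> heart K"
      using x interior_subset by (auto simp: heart_def)
  qed
  ultimately have "interior (heart K) \<noteq> {}"
    by (metis interior_maximal open_Int open_ball open_interior subset_empty)
  then show ?thesis
    by (rule aff_dim_nonempty_interior)
qed

theorem theorem2p4:
  fixes K :: "'a::euclidean_space set"
  assumes "convex_body K"
  shows "(\<forall>(k::nat) (\<omega> :: nat \<Rightarrow> 'a).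
            1 \<le> k \<and> k \<le> DIM('a) \<and>
            (\<forall>j\<in>{1..k}. \<omega> j \<in> sphere 0 1) \<and>
            inj_on \<omega> {1..k} \<and> independent (\<omega> ` {1..k}) \<and>
            (\<forall>j\<in>{1..k}. dir_symmetric K (\<omega> j)) \<longrightarrow>
              (\<forall>j\<in>{1..k}. max_folding K (\<omega> j) = center_of_mass K \<bullet> \<omega> j) \<and>
              heart K \<subseteq> (\<Inter>j\<in>{1..k}. hyperplane (max_folding K (\<omega> j)) (\<omega> j)) \<and>
              aff_codim (heart K) \<ge> int k) \<and>
         (\<forall>k::nat.
            1 \<le> k \<and> k \<le> DIM('a) - 1 \<and> aff_dim (heart K) = int k \<longrightarrow>
              (\<exists>\<theta>\<in>sphere 0 1.
                 max_folding K \<theta> = center_of_mass K \<bullet> \<theta> \<and> dir_symmetric K \<theta>))"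
proof (intro conjI allI impI; elim conjE)
  fix k :: nat and \<omega> :: "nat \<Rightarrow> 'a"
  assume "\<forall>j\<in>{1..k}. \<omega> j \<in> sphere 0 1" and sym: "\<forall>j\<in>{1..k}. dir_symmetric K (\<omega> j)"
    and inj: "inj_on \<omega> {1..k}" and indep: "independent (\<omega> ` {1..k})"
  then have unit: "norm (\<omega> j) = 1" if "j \<in> {1..k}" for j
    using that by simp
  show fold: "\<forall>j\<in>{1..k}. max_folding K (\<omega> j) = center_of_mass K \<bullet> \<omega> j"
    using max_folding_dir_symmetric[OF assms unit] sym by blast
  have hyp: "x \<bullet> \<omega> j = center_of_mass K \<bullet> \<omega> j" if "x \<in> heart K" "j \<in> {1..k}" for x j
    using heart_subset_hyperplane[OF assms unit[OF that(2)]] sym that by (auto simp: hyperplane_def)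
  show "heart K \<subseteq> (\<Inter>j\<in>{1..k}. hyperplane (max_folding K (\<omega> j)) (\<omega> j))"
    using hyp fold by (simp add: hyperplane_def subset_iff)
  have "int (card (\<omega> ` {1..k})) \<le> aff_codim (heart K)"
    by (rule aff_codim_ge_card_normals[OF indep, where c = "center_of_mass K"]) (use hyp in blast)
  then show "int k \<le> aff_codim (heart K)"
    unfolding card_image[OF inj] by simp
next
  fix k :: nat
  assume "k \<le> DIM('a) - 1" and "aff_dim (heart K) = int k"
  then have dim: "aff_dim (heart K) \<noteq> DIM('a)"
    using DIM_positive[where 'a = 'a] by linarith
  obtain \<theta> where \<theta>: "norm \<theta> = 1"
    and min: "\<And>w. norm w = 1 \<Longrightarrow>
      max_folding K \<theta> - center_of_mass K \<bullet> \<theta> \<le> max_folding K w - center_of_mass K \<bullet> w"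
    using folding_gap_attains_min[OF assms] by blast
  have "\<not> 0 < max_folding K \<theta> - center_of_mass K \<bullet> \<theta>"
    using aff_dim_heart_if_positive_gap[OF assms _ min] dim by blast
  then have eq: "max_folding K \<theta> = center_of_mass K \<bullet> \<theta>"
    using center_of_mass_le_max_folding[OF assms \<theta>] by simp
  then have "dir_symmetric K \<theta>"
    using dir_symmetric_if_fold_at_center[OF assms \<theta>] max_folding_least(1)[OF assms \<theta>] by simp
  with \<theta> eq show "\<exists>\<theta>\<in>sphere 0 1. max_folding K \<theta> = center_of_mass K \<bullet> \<theta> \<and> dir_symmetric K \<theta>"
    by auto
qed

end
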